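(* Let $f\in\mathbb{C}[h]$ with $\deg f>1$. Then for any $\mathbb{Z}$-grading of the algebra $\mathcal{H}(f)$, there is an integer $\ell\in\mathbb{Z}$ such that, relative to that grading, $x$ is homogeneous of degree $\ell$, $y$ is homogeneous of degree $-\ell$ and $h$ is homogeneous of degree $0$.
   Context: For a polynomial $f\in\mathbb{C}[h]$, the generalized Heisenberg algebra $\mathcal{H}(f)$ is the unital associative $\mathbb{C}$-algebra with generators $x,y,h$ and defining relations $$hx=xf(h),\qquad yh=f(h)y,\qquad yx-xy=f(h)-h.$$ Here $\deg f$ is the degree of $f$ as a polynomial in $h$. A $\mathbb{Z}$-grading of $\mathcal{H}(f)$ is a $\mathbb{C}$-algebra grading, i.e. a vector space decomposition $\mathcal{H}(f)=\bigoplus_{n\in\mathbb{Z}}V_n$ with $V_mV_n\subseteq V_{m+n}$ for all $m,n\in\mathbb{Z}$. *)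

theory Defs
  imports
    "HOL-Library.Poly_Mapping"
    "HOL-Algebra.QuotRing"
    "HOL-Algebra.Module"
    "HOL-Algebra.Algebraic_Closure_Type"
    "HOL-Computational_Algebra.Polynomial"
begin

section \<open>The free algebra\<close>

text \<open>Words under concatenation form the free monoid. A separate type is used so that lists do not
  get a global \<^class>\<open>monoid_add\<close> instance. The class is the additive one because
  \<^type>\<open>poly_mapping\<close> takes its convolution product from addition of exponents; it does not
  require commutativity.\<close>

datatype 'g free_word = Free_Word (letters: "'g list")

instantiation free_word :: (type) monoid_add
begin

definition zero_free_word :: "'a free_word"
  where "0 = Free_Word []"

definition plus_free_word :: "'a free_word \<Rightarrow> 'a free_word \<Rightarrow> 'a free_word"
  where "u + v = Free_Word (letters u @ letters v)"

instance
  by standard (simp_all add: zero_free_word_def plus_free_word_def)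

end

type_synonym 'g free_algebra = "'g free_word \<Rightarrow>\<^sub>0 complex"

definition free_gen :: "'g \<Rightarrow> 'g free_algebra"
  where "free_gen g = Poly_Mapping.single (Free_Word [g]) 1"

definition free_const :: "complex \<Rightarrow> 'g free_algebra"
  where "free_const c = Poly_Mapping.single 0 c"

text \<open>\<^const>\<open>poly\<close> needs a commutative ring, so evaluation in the free algebra is written out.\<close>

definition free_eval :: "complex poly \<Rightarrow> 'g free_algebra \<Rightarrow> 'g free_algebra"
  where "free_eval p a = (\<Sum>i\<le>Polynomial.degree p. free_const (Polynomial.coeff p i) * a ^ i)"


section \<open>The generalized Heisenberg algebra\<close>

datatype heis_gen = GX | GY | GH

definition heis_relators :: "complex poly \<Rightarrow> heis_gen free_algebra set"
  where "heis_relators f =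
    (let x = free_gen GX; y = free_gen GY; h = free_gen GH; fh = free_eval f h
     in {h * x - x * fh, y * h - fh * y, (y * x - x * y) - (fh - h)})"

abbreviation free_ring :: "heis_gen free_algebra ring"
  where "free_ring \<equiv> ring_of_type_algebra"

text \<open>Ideals of HOL-Algebra are two-sided.\<close>

definition heis_ideal :: "complex poly \<Rightarrow> heis_gen free_algebra set"
  where "heis_ideal f = Idl\<^bsub>free_ring\<^esub> (heis_relators f)"

definition heis_class :: "complex poly \<Rightarrow> heis_gen free_algebra \<Rightarrow> heis_gen free_algebra set"
  where "heis_class f p = heis_ideal f +>\<^bsub>free_ring\<^esub> p"

text \<open>The record \<^type>\<open>module_ext\<close> adds a scalar multiplication to a ring; a scalar \<open>c\<close> acts as
  multiplication by \<open>c \<cdot> 1\<close>.\<close>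

definition gen_heisenberg :: "complex poly \<Rightarrow> (complex, heis_gen free_algebra set) module"
  where "gen_heisenberg f =
    ring.extend (free_ring Quot heis_ideal f)
      (module.fields (\<lambda>c a. heis_class f (free_const c) \<otimes>\<^bsub>free_ring Quot heis_ideal f\<^esub> a))"

definition heis_x :: "complex poly \<Rightarrow> heis_gen free_algebra set"
  where "heis_x f = heis_class f (free_gen GX)"

definition heis_y :: "complex poly \<Rightarrow> heis_gen free_algebra set"
  where "heis_y f = heis_class f (free_gen GY)"

definition heis_h :: "complex poly \<Rightarrow> heis_gen free_algebra set"
  where "heis_h f = heis_class f (free_gen GH)"


section \<open>Gradings\<close>

abbreviation complex_ring :: "complex ring"
  where "complex_ring \<equiv> ring_of_type_algebra"

text \<open>The second conjunct is the direct sum decomposition: every element has exactly one family of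
  homogeneous components, and that family has finite support.\<close>

definition Z_grading :: "(complex, 'a) module \<Rightarrow> (int \<Rightarrow> 'a set) \<Rightarrow> bool"
  where "Z_grading A V \<longleftrightarrow>
    (\<forall>n. submodule (V n) complex_ring A) \<and>
    (\<forall>a \<in> carrier A. \<exists>!v. (\<forall>n. v n \<in> V n) \<and> finite {n. v n \<noteq> \<zero>\<^bsub>A\<^esub>} \<and>
       a = (\<Oplus>\<^bsub>A\<^esub>n \<in> {n. v n \<noteq> \<zero>\<^bsub>A\<^esub>}. v n)) \<and>
    (\<forall>m n. \<forall>a \<in> V m. \<forall>b \<in> V n. a \<otimes>\<^bsub>A\<^esub> b \<in> V (m + n))"

definition homogeneous :: "(int \<Rightarrow> 'a set) \<Rightarrow> int \<Rightarrow> 'a \<Rightarrow> bool"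
  where "homogeneous V n a \<longleftrightarrow> a \<in> V n"


section \<open>The construction is a unital complex algebra satisfying the relations\<close>

lemma ring_of_type_algebra_simps [simp]:
  "carrier (ring_of_type_algebra :: 'a::ring_1 ring) = UNIV"
  "monoid.mult (ring_of_type_algebra :: 'a::ring_1 ring) = (*)"
  "monoid.one (ring_of_type_algebra :: 'a::ring_1 ring) = 1"
  "ring.zero (ring_of_type_algebra :: 'a::ring_1 ring) = 0"
  "ring.add (ring_of_type_algebra :: 'a::ring_1 ring) = (+)"
  by (simp_all add: ring_of_type_algebra_def fun_eq_iff)

lemma ring_free_ring: "ring free_ring"
proof -
  have "\<exists>y. y + x = 0 \<and> x + y = 0" for x :: "heis_gen free_algebra"
    by (rule exI[of _ "- x"]) simp
  then show ?thesis
    by unfold_locales (auto simp: algebra_simps Units_def)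
qed

lemma ideal_heis_ideal: "ideal (heis_ideal f) free_ring"
  unfolding heis_ideal_def by (rule ring.genideal_ideal[OF ring_free_ring]) simp

lemma gen_heisenberg_simps:
  "carrier (gen_heisenberg f) = range (heis_class f)"
  "\<zero>\<^bsub>gen_heisenberg f\<^esub> = heis_class f 0"
  "\<one>\<^bsub>gen_heisenberg f\<^esub> = heis_class f 1"
  "heis_class f p \<oplus>\<^bsub>gen_heisenberg f\<^esub> heis_class f q = heis_class f (p + q)"
  "heis_class f p \<otimes>\<^bsub>gen_heisenberg f\<^esub> heis_class f q = heis_class f (p * q)"
  "c \<odot>\<^bsub>gen_heisenberg f\<^esub> heis_class f q = heis_class f (free_const c * q)"
proof -
  interpret ideal "heis_ideal f" free_ring
    by (rule ideal_heis_ideal)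
  show "carrier (gen_heisenberg f) = range (heis_class f)"
    by (auto simp: gen_heisenberg_def heis_class_def FactRing_def ring.defs module.defs A_RCOSETS_def'
        a_r_coset_def)
  show "\<zero>\<^bsub>gen_heisenberg f\<^esub> = heis_class f 0"
    using a_coset_add_zero[OF a_subset]
    by (simp add: gen_heisenberg_def heis_class_def FactRing_def ring.defs module.defs)
  show "\<one>\<^bsub>gen_heisenberg f\<^esub> = heis_class f 1"
    by (simp add: gen_heisenberg_def heis_class_def FactRing_def ring.defs module.defs)
  show "heis_class f p \<oplus>\<^bsub>gen_heisenberg f\<^esub> heis_class f q = heis_class f (p + q)"
    using a_rcos_sum[of p q]
    by (simp add: gen_heisenberg_def heis_class_def FactRing_def ring.defs module.defs)
  show "heis_class f p \<otimes>\<^bsub>gen_heisenberg f\<^esub> heis_class f q = heis_class f (p * q)"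
    using rcoset_mult_add[of p q]
    by (simp add: gen_heisenberg_def heis_class_def FactRing_def ring.defs module.defs)
  show "c \<odot>\<^bsub>gen_heisenberg f\<^esub> heis_class f q = heis_class f (free_const c * q)"
    using rcoset_mult_add[of "free_const c" q]
    by (simp add: gen_heisenberg_def heis_class_def FactRing_def ring.defs module.defs)
qed

lemma heis_class_eq_iff: "heis_class f p = heis_class f q \<longleftrightarrow> p - q \<in> heis_ideal f"
proof -
  interpret ideal "heis_ideal f" free_ring
    by (rule ideal_heis_ideal)
  have minus: "a \<ominus>\<^bsub>free_ring\<^esub> b = a - b" for a b
  proof -
    have "\<ominus>\<^bsub>free_ring\<^esub> b = - b"
      by (rule minus_equality) simp_all
    then show ?thesis
      by (simp add: a_minus_def)
  qed
  show ?thesis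
    using quotient_eq_iff_same_a_r_cos[OF ideal_heis_ideal, of p q]
    by (auto simp: heis_class_def minus)
qed

lemma ring_gen_heisenberg: "ring (gen_heisenberg f)"
proof (rule ringI)
  show "abelian_group (gen_heisenberg f)"
  proof (rule abelian_groupI)
    fix a assume "a \<in> carrier (gen_heisenberg f)"
    then obtain p where a: "a = heis_class f p"
      by (auto simp: gen_heisenberg_simps)
    then have "heis_class f (- p) \<oplus>\<^bsub>gen_heisenberg f\<^esub> a = \<zero>\<^bsub>gen_heisenberg f\<^esub>"
      by (simp add: gen_heisenberg_simps)
    then show "\<exists>b \<in> carrier (gen_heisenberg f). b \<oplus>\<^bsub>gen_heisenberg f\<^esub> a = \<zero>\<^bsub>gen_heisenberg f\<^esub>"
      by (auto simp: gen_heisenberg_simps)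
  qed (auto simp: gen_heisenberg_simps ac_simps)
  show "Group.monoid (gen_heisenberg f)"
    by (rule monoidI) (auto simp: gen_heisenberg_simps mult.assoc)
qed (auto simp: gen_heisenberg_simps distrib_left distrib_right)

lemma heis_class_minus:
  "heis_class f p \<ominus>\<^bsub>gen_heisenberg f\<^esub> heis_class f q = heis_class f (p - q)"
proof -
  interpret ring "gen_heisenberg f"
    by (rule ring_gen_heisenberg)
  have "\<ominus>\<^bsub>gen_heisenberg f\<^esub> heis_class f q = heis_class f (- q)"
    by (rule minus_equality) (simp_all add: gen_heisenberg_simps)
  then show ?thesis
    by (simp add: a_minus_def gen_heisenberg_simps)
qed

lemma free_const_add: "free_const (c + d) = free_const c + free_const d"
  by (simp add: free_const_def single_add)

lemma free_const_mult: "free_const (c * d) = free_const c * free_const d"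
  by (simp add: free_const_def mult_single)

lemma free_const_1: "free_const 1 = 1"
  by (simp add: free_const_def)

lemma free_const_commute: "free_const c * p = p * free_const c"
proof (induction p rule: update_induct)
  case const
  then show ?case
    by simp
next
  case (update p k v)
  have "Poly_Mapping.update k v p = Poly_Mapping.single k v + p"
    using update.hyps(1)
    by (intro poly_mapping_eqI) (auto simp: lookup_update lookup_add lookup_single in_keys_iff when_def)
  with update.IH show ?case
    by (simp add: free_const_def mult_single mult.commute distrib_left distrib_right)
qed

lemma module_gen_heisenberg: "module complex_ring (gen_heisenberg f)"
proof (rule moduleI)
  show "cring complex_ring"
    by (rule cring_from_type_algebra)
  show "abelian_group (gen_heisenberg f)"
    using ring_gen_heisenberg by (rule ring.is_abelian_group)
qed (auto simp: gen_heisenberg_simps free_const_add free_const_mult free_const_1 algebra_simps)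

lemma gen_heisenberg_smult_mult:
  assumes "a \<in> carrier (gen_heisenberg f)" "b \<in> carrier (gen_heisenberg f)"
  shows "(c \<odot>\<^bsub>gen_heisenberg f\<^esub> a) \<otimes>\<^bsub>gen_heisenberg f\<^esub> b =
      c \<odot>\<^bsub>gen_heisenberg f\<^esub> (a \<otimes>\<^bsub>gen_heisenberg f\<^esub> b)"
    and "a \<otimes>\<^bsub>gen_heisenberg f\<^esub> (c \<odot>\<^bsub>gen_heisenberg f\<^esub> b) =
      c \<odot>\<^bsub>gen_heisenberg f\<^esub> (a \<otimes>\<^bsub>gen_heisenberg f\<^esub> b)"
proof -
  have "p * (free_const c * q) = free_const c * (p * q)" for p q :: "heis_gen free_algebra"
    by (metis free_const_commute mult.assoc)
  then show "(c \<odot>\<^bsub>gen_heisenberg f\<^esub> a) \<otimes>\<^bsub>gen_heisenberg f\<^esub> b =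
      c \<odot>\<^bsub>gen_heisenberg f\<^esub> (a \<otimes>\<^bsub>gen_heisenberg f\<^esub> b)"
    and "a \<otimes>\<^bsub>gen_heisenberg f\<^esub> (c \<odot>\<^bsub>gen_heisenberg f\<^esub> b) =
      c \<odot>\<^bsub>gen_heisenberg f\<^esub> (a \<otimes>\<^bsub>gen_heisenberg f\<^esub> b)"
    using assms by (auto simp: gen_heisenberg_simps mult.assoc)
qed

lemma gen_heisenberg_relations:
  fixes f
  defines "A \<equiv> gen_heisenberg f" and "fh \<equiv> heis_class f (free_eval f (free_gen GH))"
  shows "heis_h f \<otimes>\<^bsub>A\<^esub> heis_x f = heis_x f \<otimes>\<^bsub>A\<^esub> fh"
    and "heis_y f \<otimes>\<^bsub>A\<^esub> heis_h f = fh \<otimes>\<^bsub>A\<^esub> heis_y f"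
    and "heis_y f \<otimes>\<^bsub>A\<^esub> heis_x f \<ominus>\<^bsub>A\<^esub> heis_x f \<otimes>\<^bsub>A\<^esub> heis_y f = fh \<ominus>\<^bsub>A\<^esub> heis_h f"
proof -
  have "heis_relators f \<subseteq> heis_ideal f"
    unfolding heis_ideal_def by (rule ring.genideal_self[OF ring_free_ring]) simp
  then show "heis_h f \<otimes>\<^bsub>A\<^esub> heis_x f = heis_x f \<otimes>\<^bsub>A\<^esub> fh"
    and "heis_y f \<otimes>\<^bsub>A\<^esub> heis_h f = fh \<otimes>\<^bsub>A\<^esub> heis_y f"
    and "heis_y f \<otimes>\<^bsub>A\<^esub> heis_x f \<ominus>\<^bsub>A\<^esub> heis_x f \<otimes>\<^bsub>A\<^esub> heis_y f = fh \<ominus>\<^bsub>A\<^esub> heis_h f"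
    by (auto simp: A_def fh_def heis_x_def heis_y_def heis_h_def gen_heisenberg_simps
        heis_class_minus heis_class_eq_iff heis_relators_def Let_def)
qed

end

theory Submission
  imports Defs
begin

text \<open>The algebra acts on sequences of polynomials, the basis vector \<open>e\<^sub>n\<close> standing for \<open>x\<^sup>n\<close> modulo the
  left ideal generated by \<open>y\<close>. This action is faithful on the span of the monomials \<open>x\<^sup>i h\<^sup>j y\<^sup>k\<close>, which
  gives the PBW basis. Comparing degrees in \<open>y\<close>, and then in \<open>x\<close>, shows that \<open>\<H>(f)\<close> is a domain.

  Let \<open>a\<close> and \<open>b\<close> be the top degrees of \<open>h\<close> and \<open>x\<close> in a given grading. If \<open>a > 0\<close>, then \<open>h x\<close> has top
  degree \<open>a + b\<close> while \<open>x f(h)\<close> has top degree \<open>b + a deg f\<close>, which is impossible; reversing the grading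
  gives \<open>h \<in> V\<^sub>0\<close>. So every component \<open>u\<close> of \<open>x\<close> satisfies \<open>h u = u f(h)\<close>, hence maps \<open>e\<^sub>n\<close> to a
  multiple of \<open>e\<^sub>n\<^sub>+\<^sub>1\<close>, and every component \<open>v\<close> of \<open>y\<close> maps \<open>e\<^sub>n\<^sub>+\<^sub>1\<close> to a multiple of \<open>e\<^sub>n\<close> and kills
  \<open>e\<^sub>0\<close>. Such nonzero \<open>u\<close> and \<open>v\<close> cannot commute: otherwise induction on \<open>n\<close> yields \<open>v u e\<^sub>n = 0\<close> for all
  \<open>n\<close>. Were the sum of the top degrees of \<open>x\<close> and \<open>y\<close> positive, the top components would commute because
  \<open>y x - x y = f(h) - h\<close> lies in degree \<open>0\<close>. With the reversed grading, the degrees of any component of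
  \<open>x\<close> and any component of \<open>y\<close> add up to \<open>0\<close>, so each has only one.\<close>

section \<open>Normal forms\<close>

lemma free_algebra_induct [case_names zero single_add]:
  fixes p :: "'g free_algebra"
  assumes "P 0" and "\<And>u a p. P p \<Longrightarrow> P (Poly_Mapping.single u a + p)"
  shows "P p"
proof (induction p rule: update_induct)
  case const
  show ?case by (fact assms(1))
next
  case (update p k v)
  have "Poly_Mapping.update k v p = Poly_Mapping.single k v + p"
    using update.hyps(1)
    by (intro poly_mapping_eqI) (auto simp: lookup_update lookup_add lookup_single in_keys_iff when_def)
  with assms(2)[OF update.IH] show ?case by simp
qed

lemma single_Cons:
  "Poly_Mapping.single (Free_Word (g # gs)) a = free_gen g * Poly_Mapping.single (Free_Word gs) a"
  by (simp add: free_gen_def mult_single plus_free_word_def)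

lemma single_Nil: "Poly_Mapping.single (Free_Word []) a = free_const a"
  by (simp add: free_const_def zero_free_word_def)

lemma free_const_0 [simp]: "free_const 0 = 0"
  by (simp add: free_const_def)

lemma free_const_uminus: "free_const (- c) = - free_const c"
  by (simp add: free_const_def single_uminus)

lemma free_eval_atMost:
  assumes "Polynomial.degree p \<le> n"
  shows "free_eval p a = (\<Sum>i\<le>n. free_const (Polynomial.coeff p i) * a ^ i)"
  unfolding free_eval_def using assms
  by (intro sum.mono_neutral_left) (auto simp: coeff_eq_0)

lemma free_eval_0 [simp]: "free_eval 0 a = 0"
  by (simp add: free_eval_def)

lemma free_eval_pCons: "free_eval (pCons c p) a = free_const c + free_eval p a * a"
proof -
  have "Polynomial.degree (pCons c p) \<le> Suc (Polynomial.degree p)"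
    by (simp add: degree_pCons_le)
  then have "free_eval (pCons c p) a = free_const c +
      (\<Sum>i\<le>Polynomial.degree p. free_const (Polynomial.coeff p i) * a ^ Suc i)"
    by (subst free_eval_atMost, assumption, subst sum.atMost_Suc_shift) simp
  then show ?thesis
    by (simp add: free_eval_def sum_distrib_right mult.assoc power_Suc2 del: power_Suc)
qed

lemma free_eval_const [simp]: "free_eval [:c:] a = free_const c"
  by (simp add: free_eval_pCons)

lemma free_eval_id [simp]: "free_eval [:0, 1:] a = a"
  by (simp add: free_eval_pCons free_const_1)

lemma free_eval_add: "free_eval (p + q) a = free_eval p a + free_eval q a"
  by (induction p q rule: poly_induct2) (simp_all add: free_eval_pCons free_const_add algebra_simps)

lemma free_eval_uminus: "free_eval (- p) a = - free_eval p a"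
  by (induction p) (simp_all add: free_eval_pCons free_const_uminus algebra_simps)

lemma free_eval_diff: "free_eval (p - q) a = free_eval p a - free_eval q a"
  using free_eval_add[of p "- q" a] by (simp add: free_eval_uminus)

lemma free_eval_commute: "free_eval p a * a = a * free_eval p a"
proof (induction p)
  case (pCons c p)
  then show ?case
    by (simp only: free_eval_pCons distrib_left distrib_right free_const_commute mult.assoc)
qed simp

lemma free_eval_smult: "free_eval (Polynomial.smult c p) a = free_const c * free_eval p a"
  by (induction p)
    (simp_all add: free_eval_pCons free_const_mult distrib_left mult.assoc)

lemma free_eval_mult: "free_eval (p * q) a = free_eval p a * free_eval q a"
proof (induction p)
  case (pCons c p)
  then show ?case
    by (simp add: free_eval_pCons free_eval_add free_eval_smult distrib_right mult.assoc
        free_eval_commute[of q])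
qed simp

section \<open>Congruence modulo the defining ideal\<close>

locale heisenberg =
  fixes f :: "complex poly"
  assumes degree_gt_1: "Polynomial.degree f > 1"
begin

abbreviation "gx \<equiv> free_gen GX"
abbreviation "gy \<equiv> free_gen GY"
abbreviation "gh \<equiv> free_gen GH"
abbreviation "ev p \<equiv> free_eval p gh"

text \<open>Equations in the quotient are handled as congruences between representatives, so that
  the ring arithmetic of the free algebra stays available.\<close>

definition cong :: "heis_gen free_algebra \<Rightarrow> heis_gen free_algebra \<Rightarrow> bool" (infix "\<doteq>" 50)
  where "p \<doteq> q \<longleftrightarrow> p - q \<in> heis_ideal f"

lemma ideal_add: "p \<in> heis_ideal f \<Longrightarrow> q \<in> heis_ideal f \<Longrightarrow> p + q \<in> heis_ideal f"
  using additive_subgroup.a_closed[OF ideal.axioms(1)[OF ideal_heis_ideal]] by fastforce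

lemma ideal_0: "0 \<in> heis_ideal f"
  using additive_subgroup.zero_closed[OF ideal.axioms(1)[OF ideal_heis_ideal]] by fastforce

lemma ideal_mult_left: "q \<in> heis_ideal f \<Longrightarrow> p * q \<in> heis_ideal f"
  using ideal.I_l_closed[OF ideal_heis_ideal] by fastforce

lemma ideal_mult_right: "p \<in> heis_ideal f \<Longrightarrow> p * q \<in> heis_ideal f"
  using ideal.I_r_closed[OF ideal_heis_ideal] by fastforce

lemma cong_refl [simp]: "p \<doteq> p"
  by (simp add: cong_def ideal_0)

lemma cong_sym: "p \<doteq> q \<Longrightarrow> q \<doteq> p"
  unfolding cong_def using ideal_mult_left[of "p - q" "- 1"] by simp

lemma cong_trans [trans]: "p \<doteq> q \<Longrightarrow> q \<doteq> r \<Longrightarrow> p \<doteq> r"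
  unfolding cong_def using ideal_add[of "p - q" "q - r"] by simp

lemma cong_add: "p \<doteq> p' \<Longrightarrow> q \<doteq> q' \<Longrightarrow> p + q \<doteq> p' + q'"
  unfolding cong_def using ideal_add[of "p - p'" "q - q'"] by (simp add: algebra_simps)

lemma cong_mult_left: "q \<doteq> q' \<Longrightarrow> p * q \<doteq> p * q'"
  unfolding cong_def using ideal_mult_left[of "q - q'" p] by (simp add: algebra_simps)

lemma cong_mult_right: "p \<doteq> p' \<Longrightarrow> p * q \<doteq> p' * q"
  unfolding cong_def using ideal_mult_right[of "p - p'" q] by (simp add: algebra_simps)

lemma cong_mult: "p \<doteq> p' \<Longrightarrow> q \<doteq> q' \<Longrightarrow> p * q \<doteq> p' * q'"
  using cong_mult_left cong_mult_right cong_trans by metis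

lemma cong_diff: "p \<doteq> p' \<Longrightarrow> q \<doteq> q' \<Longrightarrow> p - q \<doteq> p' - q'"
  using cong_add[of p p' "(- 1) * q" "(- 1) * q'"] cong_mult_left[of q q' "- 1"] by simp

lemma cong_diff_0_iff: "p - q \<doteq> 0 \<longleftrightarrow> p \<doteq> q"
  by (simp add: cong_def)

lemma cong_sum: "(\<And>i. i \<in> A \<Longrightarrow> p i \<doteq> q i) \<Longrightarrow> sum p A \<doteq> sum q A"
  by (induction A rule: infinite_finite_induct) (auto intro: cong_add)

section \<open>Commutation rules for the generators\<close>

lemma rel_hx: "gh * gx \<doteq> gx * ev f"
    and rel_yh: "gy * gh \<doteq> ev f * gy"
    and rel_yx: "gy * gx - gx * gy \<doteq> ev f - gh"
proof -
  have "heis_relators f \<subseteq> heis_ideal f"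
    unfolding heis_ideal_def by (rule ring.genideal_self[OF ring_free_ring]) simp
  then show "gh * gx \<doteq> gx * ev f" "gy * gh \<doteq> ev f * gy" "gy * gx - gx * gy \<doteq> ev f - gh"
    by (auto simp: heis_relators_def Let_def cong_def)
qed

text \<open>By \<open>rel_hx\<close>, moving \<open>h\<close> past \<open>x\<close> substitutes
  \<open>f\<close> for \<open>h\<close>; induction along the Horner scheme extends this to all
  polynomials in \<open>h\<close>.\<close>

lemma ev_mult_x: "ev b * gx \<doteq> gx * ev (b \<circ>\<^sub>p f)"
proof (induction b)
  case (pCons c b)
  have "ev (pCons c b) * gx = free_const c * gx + ev b * (gh * gx)"
    by (simp add: free_eval_pCons algebra_simps)
  also have "\<dots> \<doteq> free_const c * gx + ev b * (gx * ev f)"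
    by (intro cong_add cong_mult_left rel_hx) simp
  also have "\<dots> = gx * free_const c + (ev b * gx) * ev f"
    by (simp add: free_const_commute mult.assoc)
  also have "\<dots> \<doteq> gx * free_const c + (gx * ev (b \<circ>\<^sub>p f)) * ev f"
    by (intro cong_add cong_mult_right pCons.IH) simp
  also have "\<dots> = gx * ev (pCons c b \<circ>\<^sub>p f)"
    by (simp add: pcompose_pCons free_eval_add mult.commute[of f] free_eval_mult distrib_left mult.assoc)
  finally show ?case .
qed simp

lemma y_mult_ev: "gy * ev b \<doteq> ev (b \<circ>\<^sub>p f) * gy"
proof (induction b)
  case (pCons c b)
  have "gy * ev (pCons c b) = free_const c * gy + (gy * ev b) * gh"
    by (simp add: free_eval_pCons free_const_commute distrib_left mult.assoc)
  also have "\<dots> \<doteq> free_const c * gy + (ev (b \<circ>\<^sub>p f) * gy) * gh"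
    by (intro cong_add cong_mult_right pCons.IH) simp
  also have "\<dots> = free_const c * gy + ev (b \<circ>\<^sub>p f) * (gy * gh)"
    by (simp add: mult.assoc)
  also have "\<dots> \<doteq> free_const c * gy + ev (b \<circ>\<^sub>p f) * (ev f * gy)"
    by (intro cong_add cong_mult_left rel_yh) simp
  also have "\<dots> = ev (pCons c b \<circ>\<^sub>p f) * gy"
    by (simp add: pcompose_pCons free_eval_add mult.commute[of f] free_eval_mult distrib_right mult.assoc)
  finally show ?case .
qed simp

lemma y_mult_x: "gy * gx \<doteq> gx * gy + ev (f - [:0, 1:])"
  using cong_add[OF rel_yx cong_refl[of "gx * gy"]] by (simp add: free_eval_diff algebra_simps)

text \<open>\<open>P\<close> is read as a polynomial in \<open>x\<close> over polynomials in
  \<open>h\<close>, so \<open>nfx P\<close> is the sum of the \<open>x^i * ev (coeff P i)\<close>.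
  The outer layer in \<open>nf\<close> puts powers of \<open>y\<close> on the right: triply nested
  polynomials encode combinations of the monomials \<open>x^i h^j y^k\<close>.\<close>

definition nfx :: "complex poly poly \<Rightarrow> heis_gen free_algebra"
  where "nfx P = fold_coeffs (\<lambda>c a. ev c + gx * a) P 0"

definition nf :: "complex poly poly poly \<Rightarrow> heis_gen free_algebra"
  where "nf U = fold_coeffs (\<lambda>P a. nfx P + a * gy) U 0"

lemma nfx_0 [simp]: "nfx 0 = 0"
  by (simp add: nfx_def)

lemma nfx_pCons: "nfx (pCons c P) = ev c + gx * nfx P"
  by (cases "c = 0 \<and> P = 0") (auto simp: nfx_def)

lemma nf_0 [simp]: "nf 0 = 0"
  by (simp add: nf_def)

lemma nf_pCons: "nf (pCons P U) = nfx P + nf U * gy"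
  by (cases "P = 0 \<and> U = 0") (auto simp: nf_def)

lemma nfx_add: "nfx (P + Q) = nfx P + nfx Q"
  by (induction P Q rule: poly_induct2) (simp_all add: nfx_pCons free_eval_add algebra_simps)

lemma nf_add: "nf (U + V) = nf U + nf V"
  by (induction U V rule: poly_induct2) (simp_all add: nf_pCons nfx_add algebra_simps)

section \<open>Degrees of products of normal forms\<close>

lemma pcompose_f_eq_0_iff: "b \<circ>\<^sub>p f = 0 \<longleftrightarrow> b = 0"
  using degree_gt_1 pcompose_eq_0[of b f] by auto

text \<open>Past \<open>x^i\<close>, the factor \<open>b\<close> becomes its composite with the
  \<open>i\<close>-th iterate of \<open>f\<close>, nonzero because \<open>f\<close> is not constant.
  Each coefficient is thus multiplied by a nonzero polynomial.\<close>

lemma ev_mult_nfx: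
  assumes "b \<noteq> 0"
  shows "\<exists>S. ev b * nfx P \<doteq> nfx S \<and> Polynomial.degree S = Polynomial.degree P \<and> (S = 0 \<longleftrightarrow> P = 0)"
  using assms
proof (induction P arbitrary: b)
  case 0
  show ?case by (intro exI[of _ 0]) simp
next
  case (pCons c P)
  obtain S where S: "ev (b \<circ>\<^sub>p f) * nfx P \<doteq> nfx S"
    "Polynomial.degree S = Polynomial.degree P" "S = 0 \<longleftrightarrow> P = 0"
    using pCons.IH[of "b \<circ>\<^sub>p f"] pCons.prems pcompose_f_eq_0_iff by auto
  have "ev b * nfx (pCons c P) = ev (b * c) + (ev b * gx) * nfx P"
    by (simp add: nfx_pCons free_eval_mult algebra_simps)
  also have "\<dots> \<doteq> ev (b * c) + (gx * ev (b \<circ>\<^sub>p f)) * nfx P"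
    by (intro cong_add cong_mult_right ev_mult_x) simp
  also have "\<dots> = ev (b * c) + gx * (ev (b \<circ>\<^sub>p f) * nfx P)"
    by (simp add: mult.assoc)
  also have "\<dots> \<doteq> ev (b * c) + gx * nfx S"
    by (intro cong_add cong_mult_left S) simp
  also have "\<dots> = nfx (pCons (b * c) S)"
    by (simp add: nfx_pCons)
  finally show ?case
    using S(2,3) pCons.prems by (intro exI[of _ "pCons (b * c) S"]) (auto simp: degree_pCons_eq_if)
qed

lemma nfx_mult_nfx:
  assumes "P \<noteq> 0" "Q \<noteq> 0"
  shows "\<exists>S. nfx P * nfx Q \<doteq> nfx S \<and>
    Polynomial.degree S = Polynomial.degree P + Polynomial.degree Q \<and> S \<noteq> 0"
  using assms
proof (induction P)
  case (pCons c P)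
  \<comment> \<open>For \<open>c = 0\<close> the choice is \<open>C = 0\<close>. Only the degree
    bound is left then, which suffices beside a term of higher degree.\<close>
  obtain C where C: "ev c * nfx Q \<doteq> nfx C" "Polynomial.degree C \<le> Polynomial.degree Q"
    "c \<noteq> 0 \<Longrightarrow> Polynomial.degree C = Polynomial.degree Q \<and> C \<noteq> 0"
    using ev_mult_nfx[of c Q] \<open>Q \<noteq> 0\<close> by (cases "c = 0") (auto intro: that[of 0] that)
  have *: "nfx (pCons c P) * nfx Q = ev c * nfx Q + gx * (nfx P * nfx Q)"
    by (simp add: nfx_pCons algebra_simps)
  show ?case
  proof (cases "P = 0")
    case True
    then show ?thesis
      using C pCons.hyps * by (intro exI[of _ C]) auto
  next
    case False
    then obtain S where S: "nfx P * nfx Q \<doteq> nfx S"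
      "Polynomial.degree S = Polynomial.degree P + Polynomial.degree Q" "S \<noteq> 0"
      using pCons by blast
    have "nfx (pCons c P) * nfx Q \<doteq> nfx C + gx * nfx S"
      unfolding * by (intro cong_add cong_mult_left C S)
    also have "\<dots> = nfx (C + pCons 0 S)"
      by (simp add: nfx_add nfx_pCons)
    finally have 1: "nfx (pCons c P) * nfx Q \<doteq> nfx (C + pCons 0 S)" .
    have 2: "Polynomial.degree (C + pCons 0 S) = Suc (Polynomial.degree S)"
      using C(2) S by (subst degree_add_eq_right) auto
    then have "C + pCons 0 S \<noteq> 0"
      by auto
    with 1 2 show ?thesis
      using False S(2) by (intro exI[of _ "C + pCons 0 S"]) auto
  qed
qed simp

text \<open>A left factor free of \<open>y\<close> acts separately on the coefficient of each power
  of \<open>y\<close>, and \<open>nfx_mult_nfx\<close> keeps nonzero coefficients nonzero.\<close>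

lemma nfx_mult_nf:
  assumes "P \<noteq> 0"
  shows "\<exists>W. nfx P * nf U \<doteq> nf W \<and> Polynomial.degree W = Polynomial.degree U \<and> (W = 0 \<longleftrightarrow> U = 0)"
proof (induction U)
  case 0
  show ?case by (intro exI[of _ 0]) simp
next
  case (pCons Q U)
  then obtain W where W: "nfx P * nf U \<doteq> nf W" "Polynomial.degree W = Polynomial.degree U"
    "W = 0 \<longleftrightarrow> U = 0"
    by blast
  obtain S where S: "nfx P * nfx Q \<doteq> nfx S" "S = 0 \<longleftrightarrow> Q = 0"
    using nfx_mult_nfx[of P Q] assms by (cases "Q = 0") (auto intro: exI[of _ 0])
  have "nfx P * nf (pCons Q U) = nfx P * nfx Q + (nfx P * nf U) * gy"
    by (simp add: nf_pCons algebra_simps)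
  also have "\<dots> \<doteq> nfx S + nf W * gy"
    by (intro cong_add cong_mult_right W S)
  also have "\<dots> = nf (pCons S W)"
    by (simp add: nf_pCons)
  finally show ?case
    using W S by (intro exI[of _ "pCons S W"]) (auto simp: degree_pCons_eq_if)
qed

text \<open>Only the part that keeps \<open>y\<close> is tracked: there every coefficient is
  composed with \<open>f\<close>, which sends no nonzero polynomial to 0. The terms
  \<open>f(h) - h\<close> arising when \<open>y\<close> crosses an \<open>x\<close> are free of
  \<open>y\<close> and are collected in \<open>Q\<close>.\<close>

lemma y_mult_nfx: "\<exists>T Q. gy * nfx P \<doteq> nfx T * gy + nfx Q \<and> (T = 0 \<longleftrightarrow> P = 0)"
proof (induction P)
  case 0
  show ?case by (intro exI[of _ 0]) simp
next
  case (pCons c P)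
  then obtain T Q where TQ: "gy * nfx P \<doteq> nfx T * gy + nfx Q" "T = 0 \<longleftrightarrow> P = 0"
    by blast
  have "f - [:0, 1:] \<noteq> 0"
    using degree_gt_1 by auto
  then obtain S where S: "ev (f - [:0, 1:]) * nfx P \<doteq> nfx S"
    using ev_mult_nfx by blast
  have "gy * nfx (pCons c P) = gy * ev c + (gy * gx) * nfx P"
    by (simp add: nfx_pCons algebra_simps)
  also have "\<dots> \<doteq> ev (c \<circ>\<^sub>p f) * gy + (gx * gy + ev (f - [:0, 1:])) * nfx P"
    by (intro cong_add cong_mult_right y_mult_ev y_mult_x)
  also have "\<dots> = ev (c \<circ>\<^sub>p f) * gy + (gx * (gy * nfx P) + ev (f - [:0, 1:]) * nfx P)"
    by (simp add: distrib_right mult.assoc)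
  also have "\<dots> \<doteq> ev (c \<circ>\<^sub>p f) * gy + (gx * (nfx T * gy + nfx Q) + nfx S)"
    by (intro cong_add cong_mult_left TQ S) simp
  also have "\<dots> = nfx (pCons (c \<circ>\<^sub>p f) T) * gy + nfx (pCons 0 Q + S)"
    by (simp add: nfx_pCons nfx_add algebra_simps)
  finally show ?case
    using TQ(2) pcompose_f_eq_0_iff[of c]
    by (intro exI[of _ "pCons (c \<circ>\<^sub>p f) T"] exI[of _ "pCons 0 Q + S"]) auto
qed

lemma y_mult_nf:
  assumes "U \<noteq> 0"
  shows "\<exists>W. gy * nf U \<doteq> nf W \<and> Polynomial.degree W = Suc (Polynomial.degree U) \<and> W \<noteq> 0"
  using assms
proof (induction U)
  case (pCons P U)
  obtain T Q where TQ: "gy * nfx P \<doteq> nfx T * gy + nfx Q" "T = 0 \<longleftrightarrow> P = 0"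
    using y_mult_nfx by blast
  show ?case
  proof (cases "U = 0")
    case True
    then have "gy * nf (pCons P U) \<doteq> nf [:Q, T:]"
      using TQ(1) by (simp add: nf_pCons algebra_simps)
    moreover have "T \<noteq> 0"
      using pCons True TQ by simp
    ultimately show ?thesis
      using True by (intro exI[of _ "[:Q, T:]"]) auto
  next
    case False
    then obtain W where W: "gy * nf U \<doteq> nf W" "Polynomial.degree W = Suc (Polynomial.degree U)" "W \<noteq> 0"
      using pCons by blast
    have "gy * nf (pCons P U) = gy * nfx P + (gy * nf U) * gy"
      by (simp add: nf_pCons algebra_simps)
    also have "\<dots> \<doteq> (nfx T * gy + nfx Q) + nf W * gy"
      by (intro cong_add cong_mult_right W TQ)
    also have "\<dots> = nf (pCons Q (W + [:T:]))"
      by (simp add: nf_pCons nf_add algebra_simps)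
    finally have 1: "gy * nf (pCons P U) \<doteq> nf (pCons Q (W + [:T:]))" .
    \<comment> \<open>\<open>W\<close> has positive degree, so the constant \<open>T\<close> does
      not touch its leading coefficient.\<close>
    have "Polynomial.degree (W + [:T:]) = Suc (Polynomial.degree U)"
      using W by (subst degree_add_eq_left) auto
    moreover from this have "W + [:T:] \<noteq> 0"
      by auto
    ultimately show ?thesis
      using 1 False by (intro exI[of _ "pCons Q (W + [:T:])"]) simp
  qed
qed simp

text \<open>One \<open>y\<close> at a time moves from the left factor into the right one, hence the
  induction for arbitrary \<open>W\<close>. For nonzero \<open>U\<close> the summand
  \<open>nfx P * nf W\<close> has smaller \<open>y\<close>-degree than the rest.\<close>

lemma nf_mult_nf:
  assumes "U \<noteq> 0" "W \<noteq> 0"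
  shows "\<exists>Z. nf U * nf W \<doteq> nf Z \<and>
    Polynomial.degree Z = Polynomial.degree U + Polynomial.degree W \<and> Z \<noteq> 0"
  using assms
proof (induction U arbitrary: W)
  case (pCons P U)
  obtain C where C: "nfx P * nf W \<doteq> nf C" "Polynomial.degree C \<le> Polynomial.degree W"
    "P \<noteq> 0 \<Longrightarrow> Polynomial.degree C = Polynomial.degree W \<and> C \<noteq> 0"
    using nfx_mult_nf[of P W] \<open>W \<noteq> 0\<close> by (cases "P = 0") (auto intro: that[of 0] that)
  have *: "nf (pCons P U) * nf W = nfx P * nf W + nf U * (gy * nf W)"
    by (simp add: nf_pCons algebra_simps)
  show ?case
  proof (cases "U = 0")
    case True
    then show ?thesis
      using C pCons.hyps * by (intro exI[of _ C]) auto
  next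
    case False
    obtain Y where Y: "gy * nf W \<doteq> nf Y" "Polynomial.degree Y = Suc (Polynomial.degree W)" "Y \<noteq> 0"
      using y_mult_nf \<open>W \<noteq> 0\<close> by blast
    obtain Z where Z: "nf U * nf Y \<doteq> nf Z"
      "Polynomial.degree Z = Polynomial.degree U + Polynomial.degree Y" "Z \<noteq> 0"
      using pCons.IH[OF False Y(3)] by blast
    have "nf (pCons P U) * nf W \<doteq> nf C + nf U * nf Y"
      unfolding * by (intro cong_add cong_mult_left C Y)
    also have "\<dots> \<doteq> nf C + nf Z"
      by (intro cong_add cong_refl Z)
    also have "\<dots> = nf (C + Z)"
      by (simp add: nf_add)
    finally have 1: "nf (pCons P U) * nf W \<doteq> nf (C + Z)" .
    have 2: "Polynomial.degree (C + Z) = Polynomial.degree Z"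
      using C(2) Z Y(2) by (subst degree_add_eq_right) auto
    then have "C + Z \<noteq> 0"
      using Z Y(2) by auto
    with 1 2 show ?thesis
      using False Z(2) Y(2) by (intro exI[of _ "C + Z"]) auto
  qed
qed simp

section \<open>A faithful action and the absence of zero divisors\<close>

text \<open>Normal forms contain the scalars and are closed under left multiplication by each
  generator, so a word is absorbed letter by letter from its right end.\<close>

lemma nf_surj: "\<exists>U. p \<doteq> nf U"
proof -
  have const: "free_const c = nf [:[:[:c:]:]:]" for c
    by (simp add: nf_pCons nfx_pCons)
  have gen: "\<exists>U'. free_gen g * nf U \<doteq> nf U'" for g U
  proof (cases g)
    case GX
    have "gx = nfx [:0, 1:]"
      by (simp add: nfx_pCons one_pCons free_const_1)
    then show ?thesis
      using nfx_mult_nf[of "[:0, 1:]" U] GX by auto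
  next
    case GY
    then show ?thesis
      using y_mult_nf[of U] by (cases "U = 0") (auto intro: exI[of _ 0])
  next
    case GH
    have "gh = nfx [:[:0, 1:]:]"
      by (simp add: nfx_pCons)
    then show ?thesis
      using nfx_mult_nf[of "[:[:0, 1:]:]" U] GH by auto
  qed
  have word: "\<exists>U. Poly_Mapping.single (Free_Word gs) a \<doteq> nf U" for gs a
  proof (induction gs)
    case Nil
    then show ?case
      using cong_refl[of "free_const a"] by (metis const single_Nil)
  next
    case (Cons g gs)
    then show ?case
      using gen[of g] by (metis cong_mult_left cong_trans single_Cons)
  qed
  show ?thesis
  proof (induction p rule: free_algebra_induct)
    case zero
    show ?case by (intro exI[of _ 0]) simp
  next
    case (single_add u a p)
    moreover obtain U where "Poly_Mapping.single u a \<doteq> nf U"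
      using word[of "letters u" a] by auto
    ultimately show ?case
      using cong_add nf_add by metis
  qed
qed

section \<open>Iterates of \<open>f\<close> and the action on sequences\<close>

definition iter :: "nat \<Rightarrow> complex poly"
  where "iter n = ((\<lambda>b. b \<circ>\<^sub>p f) ^^ n) [:0, 1:]"

lemma iter_0 [simp]: "iter 0 = [:0, 1:]"
  by (simp add: iter_def)

lemma iter_Suc: "iter (Suc n) = iter n \<circ>\<^sub>p f"
  by (simp add: iter_def)

lemma pcompose_id_left [simp]: "[:0, 1:] \<circ>\<^sub>p b = (b :: complex poly)"
  by (simp add: pcompose_pCons)

lemma iter_Suc': "iter (Suc n) = f \<circ>\<^sub>p iter n"
  by (induction n) (simp_all add: iter_Suc flip: pcompose_assoc)

lemma degree_iter: "Polynomial.degree (iter n) = Polynomial.degree f ^ n"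
  by (induction n) (simp_all add: iter_Suc degree_pcompose)

text \<open>The degrees \<open>degree f ^ n\<close> are distinct because
  \<open>degree f > 1\<close>. Since \<open>iter n\<close> is the eigenvalue of \<open>h\<close> on
  \<open>e_n\<close>, the eigenvalues of \<open>h\<close> are pairwise distinct.\<close>

lemma inj_iter: "iter m = iter n \<longleftrightarrow> m = n"
  using degree_iter[of m] degree_iter[of n] degree_gt_1 by (metis power_inject_exp)

text \<open>A sequence \<open>w\<close> stands for the formal sum of the \<open>x^i * w i\<close>,
  with \<open>w i\<close> a polynomial in \<open>h\<close>. Moving \<open>y\<close> through
  \<open>x^(i+1)\<close> leaves one term \<open>f(h) - h\<close> per crossing; pushed to the right,
  these telescope to \<open>iter (Suc i) - [:0, 1:]\<close>.\<close>

definition gen_act :: "heis_gen \<Rightarrow> (nat \<Rightarrow> complex poly) \<Rightarrow> nat \<Rightarrow> complex poly"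
  where "gen_act g w i = (case g of
      GX \<Rightarrow> (case i of 0 \<Rightarrow> 0 | Suc j \<Rightarrow> w j)
    | GY \<Rightarrow> (iter (Suc i) - [:0, 1:]) * w (Suc i)
    | GH \<Rightarrow> iter i * w i)"

definition act :: "heis_gen free_algebra \<Rightarrow> (nat \<Rightarrow> complex poly) \<Rightarrow> nat \<Rightarrow> complex poly"
  where "act p w i = (\<Sum>u \<in> Poly_Mapping.keys p. [:Poly_Mapping.lookup p u:] * foldr gen_act (letters u) w i)"

lemma gen_act_add: "gen_act g (\<lambda>i. v i + w i) = (\<lambda>i. gen_act g v i + gen_act g w i)"
  by (auto simp: gen_act_def fun_eq_iff algebra_simps split: heis_gen.split nat.split)

lemma gen_act_mult: "gen_act g (\<lambda>i. b * w i) = (\<lambda>i. b * gen_act g w i)"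
  by (auto simp: gen_act_def fun_eq_iff algebra_simps split: heis_gen.split nat.split)

lemma foldr_act_add:
  "foldr gen_act gs (\<lambda>i. v i + w i) = (\<lambda>i. foldr gen_act gs v i + foldr gen_act gs w i)"
  by (induction gs) (simp_all add: gen_act_add)

lemma foldr_act_mult: "foldr gen_act gs (\<lambda>i. b * w i) = (\<lambda>i. b * foldr gen_act gs w i)"
  by (induction gs) (simp_all add: gen_act_mult)

lemma foldr_act_0: "foldr gen_act gs (\<lambda>i. 0) = (\<lambda>i. 0)"
  using foldr_act_mult[of gs 0 "\<lambda>i. 0"] by simp

lemma act_superset:
  assumes "finite A" "Poly_Mapping.keys p \<subseteq> A"
  shows "act p w i = (\<Sum>u \<in> A. [:Poly_Mapping.lookup p u:] * foldr gen_act (letters u) w i)"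
  unfolding act_def using assms
  by (intro sum.mono_neutral_left) (auto simp: in_keys_iff)

lemma act_add: "act (p + q) w i = act p w i + act q w i"
proof -
  let ?A = "Poly_Mapping.keys p \<union> Poly_Mapping.keys q"
  have "Poly_Mapping.keys (p + q) \<subseteq> ?A"
    by (rule Poly_Mapping.keys_add)
  then show ?thesis
    by (simp add: act_superset[of ?A] lookup_add sum.distrib smult_add_left)
qed

lemma act_0 [simp]: "act 0 w i = 0"
  by (simp add: act_def)

lemma act_single: "act (Poly_Mapping.single u a) w i = [:a:] * foldr gen_act (letters u) w i"
  by (cases "a = 0") (simp_all add: act_def)

lemma act_uminus: "act (- p) w i = - act p w i"
  using act_add[of p "- p" w i] by (simp add: eq_neg_iff_add_eq_0 add.commute)

lemma act_diff: "act (p - q) w i = act p w i - act q w i"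
  using act_add[of p "- q" w i] by (simp add: act_uminus)

lemma act_arg_mult: "act p (\<lambda>i. b * w i) i = b * act p w i"
  by (simp add: act_def foldr_act_mult sum_distrib_left algebra_simps)

lemma act_arg_0 [simp]: "act p (\<lambda>i. 0) i = 0"
  by (simp add: act_def foldr_act_0)

lemma act_single_mult: "act (Poly_Mapping.single u a * q) w i =
    [:a:] * foldr gen_act (letters u) (act q w) i"
proof (induction q arbitrary: i rule: free_algebra_induct)
  case zero
  have "act 0 w = (\<lambda>i. 0)"
    by (simp add: fun_eq_iff)
  then show ?case
    by (simp add: foldr_act_0)
next
  case (single_add v b q)
  have "act (Poly_Mapping.single v b + q) w =
      (\<lambda>i. [:b:] * foldr gen_act (letters v) w i + act q w i)"
    by (simp add: fun_eq_iff act_add act_single)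
  moreover have "[:a * b:] = [:a:] * [:b:]"
    by simp
  ultimately show ?case
    by (simp only: distrib_left act_add single_add.IH mult_single act_single foldr_act_add
        foldr_act_mult plus_free_word_def free_word.sel foldr_append o_apply mult.assoc)
qed

lemma act_mult: "act (p * q) w i = act p (act q w) i"
  by (induction p rule: free_algebra_induct)
    (simp_all add: distrib_right act_add act_single_mult act_single)

lemma act_gen: "act (free_gen g) w = gen_act g w"
  by (simp add: fun_eq_iff free_gen_def act_single one_pCons)

lemma act_const: "act (free_const c) w i = [:c:] * w i"
  by (simp add: free_const_def act_single zero_free_word_def)

lemma act_ev: "act (ev b) w i = (b \<circ>\<^sub>p iter i) * w i"
proof (induction b arbitrary: w)
  case (pCons c b)
  then show ?case
    by (simp add: free_eval_pCons act_add act_const act_mult act_gen gen_act_def pcompose_pCons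
        algebra_simps)
qed simp

lemma act_relator:
  assumes "p \<in> heis_relators f"
  shows "act p w i = 0"
proof -
  consider "p = gh * gx - gx * ev f" | "p = gy * gh - ev f * gy"
    | "p = (gy * gx - gx * gy) - (ev f - gh)"
    using assms by (auto simp: heis_relators_def Let_def)
  then show ?thesis
  proof cases
    case 1
    then show ?thesis
      by (simp add: act_diff act_mult act_gen act_ev gen_act_def iter_Suc' split: nat.split)
  next
    case 2
    then show ?thesis
      by (simp add: act_diff act_mult act_gen act_ev gen_act_def iter_Suc')
  next
    case 3
    then show ?thesis
      unfolding 3
      \<comment> \<open>The factors from \<open>y x\<close> and \<open>x y\<close> differ by
        \<open>iter (Suc i) - iter i\<close>, which is how \<open>f(h) - h\<close> acts. At
        \<open>i = 0\<close> the term \<open>x y\<close> vanishes, in accordance with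
        \<open>iter 0\<close> being the variable.\<close>
      by (cases i) (simp_all add: act_diff act_mult act_gen act_ev gen_act_def iter_Suc' left_diff_distrib)
  qed
qed

text \<open>The elements acting as zero form a two-sided ideal that contains the relators, hence
  also the ideal they generate.\<close>

lemma act_ideal:
  assumes "p \<in> heis_ideal f"
  shows "act p w i = 0"
proof -
  let ?K = "{p. \<forall>w i. act p w i = 0}"
  have "ideal ?K free_ring"
  proof (rule idealI[OF ring_free_ring])
    have inv: "inv\<^bsub>add_monoid free_ring\<^esub> p = - p" for p :: "heis_gen free_algebra"
    proof -
      interpret ring free_ring by (rule ring_free_ring)
      have "\<ominus>\<^bsub>free_ring\<^esub> p = - p"
        by (rule minus_equality) simp_all
      then show ?thesis
        by (simp add: a_inv_def)
    qed
    have "inv\<^bsub>add_monoid free_ring\<^esub> p \<in> ?K" if "p \<in> ?K" for p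
      unfolding inv using that by (simp add: act_uminus)
    then show "subgroup ?K (add_monoid free_ring)"
      by (intro subgroup.intro) (simp_all add: act_add)
  next
    fix p q assume "p \<in> ?K"
    then have "act p w = (\<lambda>i. 0)" for w
      by auto
    then show "q \<otimes>\<^bsub>free_ring\<^esub> p \<in> ?K" "p \<otimes>\<^bsub>free_ring\<^esub> q \<in> ?K"
      by (simp_all add: act_mult)
  qed
  moreover have "heis_relators f \<subseteq> ?K"
    using act_relator by blast
  ultimately have "heis_ideal f \<subseteq> ?K"
    unfolding heis_ideal_def by (rule ring.genideal_minimal[OF ring_free_ring])
  with assms show ?thesis
    by blast
qed

lemma act_cong: "p \<doteq> q \<Longrightarrow> act p w i = act q w i"
  using act_ideal[of "p - q" w i] by (simp add: cong_def act_diff)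

section \<open>Faithfulness and the domain property\<close>

definition basis :: "nat \<Rightarrow> nat \<Rightarrow> complex poly"
  where "basis n i = (if i = n then 1 else 0)"

lemma act_nfx_basis_0: "act (nfx P) (basis 0) i = Polynomial.coeff P i"
proof (induction P arbitrary: i)
  case (pCons c P)
  then show ?case
    by (simp add: nfx_pCons act_add act_ev act_mult act_gen gen_act_def basis_def coeff_pCons
        split: nat.split)
qed simp

lemma act_y_basis_0: "act gy (basis 0) = (\<lambda>i. 0)"
  by (simp add: act_gen gen_act_def basis_def fun_eq_iff)

lemma act_y_basis_Suc: "act gy (basis (Suc n)) = (\<lambda>i. (iter (Suc n) - [:0, 1:]) * basis n i)"
  by (simp add: act_gen gen_act_def basis_def fun_eq_iff)

text \<open>As \<open>y\<close> kills \<open>e_0\<close>, the values on \<open>e_0\<close> are the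
  coefficients of the part \<open>P\<close> free of \<open>y\<close>. Once \<open>P = 0\<close>,
  every term ends in \<open>y\<close>, which maps \<open>e_(n+1)\<close> to a nonzero multiple of
  \<open>e_n\<close>; this factor cancels and the induction applies.\<close>

lemma nf_faithful:
  assumes "\<And>n i. act (nf U) (basis n) i = 0"
  shows "U = 0"
  using assms
proof (induction U)
  case (pCons P U)
  have "Polynomial.coeff P i = 0" for i
    using pCons.prems[of 0 i] by (simp add: nf_pCons act_add act_mult act_y_basis_0 act_nfx_basis_0)
  then have P: "P = 0"
    by (simp add: poly_eq_iff)
  have "act (nf U) (basis n) i = 0" for n i
  proof -
    have "(iter (Suc n) - [:0, 1:]) * act (nf U) (basis n) i = 0"
      using pCons.prems[of "Suc n" i]
      by (simp add: nf_pCons P act_mult act_y_basis_Suc act_arg_mult)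
    moreover have "iter (Suc n) - [:0, 1:] \<noteq> 0"
      using inj_iter[of "Suc n" 0] by simp
    ultimately show ?thesis
      by simp
  qed
  with pCons.IH P show ?case
    by simp
qed simp

lemma cong_0_iff_act: "p \<doteq> 0 \<longleftrightarrow> (\<forall>n i. act p (basis n) i = 0)"
proof
  assume *: "\<forall>n i. act p (basis n) i = 0"
  obtain U where U: "p \<doteq> nf U"
    using nf_surj by blast
  then have "U = 0"
    using * act_cong[OF U] by (intro nf_faithful) simp
  with U show "p \<doteq> 0"
    by simp
qed (simp add: act_cong[of p 0])

lemma nf_cong_0_iff: "nf U \<doteq> 0 \<longleftrightarrow> U = 0"
  using nf_faithful[of U] by (auto simp: cong_0_iff_act)

text \<open>Nonzero factors have nonzero normal forms, whose product has a nonzero normal form by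
  \<open>nf_mult_nf\<close>, and by faithfulness such a form is not congruent to 0.\<close>

lemma cong_0_prime:
  assumes "p * q \<doteq> 0"
  shows "p \<doteq> 0 \<or> q \<doteq> 0"
proof (rule ccontr)
  assume *: "\<not> (p \<doteq> 0 \<or> q \<doteq> 0)"
  obtain U W where UW: "p \<doteq> nf U" "q \<doteq> nf W"
    using nf_surj by metis
  with * have "U \<noteq> 0" "W \<noteq> 0"
    by auto
  then obtain Z where "nf U * nf W \<doteq> nf Z" "Z \<noteq> 0"
    using nf_mult_nf by blast
  with assms UW have "nf Z \<doteq> 0"
    by (meson cong_mult cong_sym cong_trans)
  with \<open>Z \<noteq> 0\<close> show False
    by (simp add: nf_cong_0_iff)
qed

lemma x_not_cong_0: "\<not> gx \<doteq> 0"
  and y_not_cong_0: "\<not> gy \<doteq> 0"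
  and h_not_cong_0: "\<not> gh \<doteq> 0"
proof -
  have "gx = nf [:[:0, 1:]:]" "gy = nf [:0, 1:]" "gh = nf [:[:[:0, 1:]:]:]"
    by (simp_all add: nf_pCons nfx_pCons one_pCons free_const_1)
  then show "\<not> gx \<doteq> 0" "\<not> gy \<doteq> 0" "\<not> gh \<doteq> 0"
    by (simp_all add: nf_cong_0_iff)
qed

section \<open>Operators that shift the eigenvectors of \<open>h\<close>\<close>

lemma act_raising:
  assumes "gh * u \<doteq> u * ev f"
  shows "act u (basis n) = (\<lambda>i. act u (basis n) (Suc n) * basis (Suc n) i)"
proof
  fix i
  have "act (ev f) (basis n) = (\<lambda>i. iter (Suc n) * basis n i)"
    by (auto simp: fun_eq_iff act_ev iter_Suc' basis_def)
  \<comment> \<open>The relation makes \<open>u e_n\<close> an eigenvector of \<open>h\<close> for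
    \<open>iter (Suc n)\<close>, while \<open>h\<close> scales coordinate \<open>i\<close> by
    \<open>iter i\<close>. Hence only the coordinate \<open>Suc n\<close> survives.\<close>
  then have "iter i * act u (basis n) i = iter (Suc n) * act u (basis n) i"
    using act_cong[OF assms, of "basis n" i]
    by (simp add: act_mult act_gen gen_act_def act_arg_mult)
  then show "act u (basis n) i = act u (basis n) (Suc n) * basis (Suc n) i"
    using inj_iter[of i "Suc n"] by (auto simp: basis_def)
qed

text \<open>A nonzero coordinate \<open>i\<close> of \<open>v e_n\<close> forces
  \<open>iter (Suc i) = iter n\<close>, so \<open>n = Suc i\<close>; for \<open>n = 0\<close> there
  is no such \<open>i\<close>.\<close>

lemma act_lowering:
  assumes "v * gh \<doteq> ev f * v"
  shows "act v (basis 0) = (\<lambda>i. 0)"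
    and "act v (basis (Suc n)) = (\<lambda>i. act v (basis (Suc n)) n * basis n i)"
proof -
  have *: "iter (Suc i) = iter n \<or> act v (basis n) i = 0" for i n
  proof -
    have "act gh (basis n) = (\<lambda>i. iter n * basis n i)"
      by (auto simp: fun_eq_iff act_gen gen_act_def basis_def)
    then have "iter n * act v (basis n) i = iter (Suc i) * act v (basis n) i"
      using act_cong[OF assms, of "basis n" i]
      by (simp add: act_mult act_ev iter_Suc' act_arg_mult)
    then show ?thesis
      by auto
  qed
  show "act v (basis 0) = (\<lambda>i. 0)"
    using *[of _ 0] unfolding inj_iter by auto
  show "act v (basis (Suc n)) = (\<lambda>i. act v (basis (Suc n)) n * basis n i)"
    using *[of _ "Suc n"] by (auto simp: fun_eq_iff inj_iter basis_def)
qed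

lemma raising_lowering_not_commute:
  assumes u: "gh * u \<doteq> u * ev f" and v: "v * gh \<doteq> ev f * v"
    and comm: "v * u \<doteq> u * v"
  shows "u \<doteq> 0 \<or> v \<doteq> 0"
proof -
  have comm': "act v (act u (basis n)) i = act u (act v (basis n)) i" for n i
    using act_cong[OF comm] by (simp add: act_mult)
  define a where "a n = act u (basis n) (Suc n)" for n
  define b where "b n = act v (basis (Suc n)) n" for n
  have a: "act u (basis n) = (\<lambda>i. a n * basis (Suc n) i)" for n
    unfolding a_def by (rule act_raising[OF u])
  have b: "act v (basis (Suc n)) = (\<lambda>i. b n * basis n i)" for n
    unfolding b_def by (rule act_lowering[OF v])
  \<comment> \<open>Both products carry the scalar \<open>a n * b n\<close>, but \<open>v u\<close>
    on \<open>e_n\<close> and \<open>u v\<close> on \<open>e_(n+1)\<close>. Commutation therefore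
    passes its vanishing from \<open>n\<close> to \<open>n + 1\<close>.\<close>
  have vu: "act v (act u (basis n)) i = a n * (b n * basis n i)" for n i
    by (simp add: a act_arg_mult b)
  have uv: "act u (act v (basis (Suc n))) i = b n * (a n * basis (Suc n) i)" for n i
    by (simp add: b act_arg_mult a)
  have "act v (act u (basis n)) i = 0" for n i
  proof (induction n arbitrary: i)
    case 0
    show ?case
      by (simp add: comm' act_lowering(1)[OF v])
  next
    case (Suc n)
    have "a n * b n = 0"
      using Suc[of n] unfolding vu by (simp add: basis_def)
    then show ?case
      by (auto simp: comm' uv)
  qed
  then have "v * u \<doteq> 0"
    by (simp add: cong_0_iff_act act_mult)
  then show ?thesis
    using cong_0_prime by blast
qed

end

section \<open>Gradings\<close>

text \<open>\<open>W n\<close> plays the role of the preimage in the free algebra of the component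
  of degree \<open>n\<close>. The direct sum condition is split into existence and
  independence.\<close>

locale heisenberg_grading = heisenberg +
  fixes W :: "int \<Rightarrow> heis_gen free_algebra set"
  assumes W_0: "0 \<in> W n"
    and W_add: "p \<in> W n \<Longrightarrow> q \<in> W n \<Longrightarrow> p + q \<in> W n"
    and W_const: "p \<in> W n \<Longrightarrow> free_const c * p \<in> W n"
    and W_mult: "p \<in> W m \<Longrightarrow> q \<in> W n \<Longrightarrow> p * q \<in> W (m + n)"
    and W_cong: "p \<in> W n \<Longrightarrow> p \<doteq> q \<Longrightarrow> q \<in> W n"
    and W_decomp: "\<exists>S r. finite S \<and> (\<forall>n \<in> S. r n \<in> W n) \<and> p \<doteq> sum r S"
    and W_indep: "finite S \<Longrightarrow> (\<And>n. n \<in> S \<Longrightarrow> r n \<in> W n) \<Longrightarrow> sum r S \<doteq> 0 \<Longrightarrow> n \<in> S \<Longrightarrow> r n \<doteq> 0"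
begin

lemma W_uminus: "p \<in> W n \<Longrightarrow> - p \<in> W n"
  using W_const[of p n "- 1"] by (simp add: free_const_uminus free_const_1)

lemma W_diff: "p \<in> W n \<Longrightarrow> q \<in> W n \<Longrightarrow> p - q \<in> W n"
  using W_add[of p n "- q"] W_uminus by simp

text \<open>Excluding components congruent to 0 makes \<open>S\<close> the set of degrees that
  really occur, so that \<open>Max S\<close> is the top degree.\<close>

definition decomposition :: "int set \<Rightarrow> (int \<Rightarrow> heis_gen free_algebra) \<Rightarrow> heis_gen free_algebra \<Rightarrow> bool"
  where "decomposition S q p \<longleftrightarrow>
    finite S \<and> (\<forall>n \<in> S. q n \<in> W n \<and> \<not> q n \<doteq> 0) \<and> p \<doteq> sum q S"

lemma decomposition_exists: "\<exists>S q. decomposition S q p"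
proof -
  obtain S q where *: "finite S" "\<forall>n \<in> S. q n \<in> W n" "p \<doteq> sum q S"
    using W_decomp by blast
  let ?S = "{n \<in> S. \<not> q n \<doteq> 0}"
  have "sum q S \<doteq> (\<Sum>n\<in>S. if q n \<doteq> 0 then 0 else q n)"
    by (rule cong_sum) simp
  also have "\<dots> = sum q ?S"
    using * by (intro sum.mono_neutral_cong_right) auto
  finally have "p \<doteq> sum q ?S"
    using * cong_trans by blast
  then have "decomposition ?S q p"
    using * by (simp add: decomposition_def)
  then show ?thesis by blast
qed

text \<open>Subtracting \<open>p\<close> in degree \<open>m\<close> gives a relation among
  homogeneous elements, to which independence applies.\<close>

lemma W_component:
  assumes "finite S" "\<And>n. n \<in> S \<Longrightarrow> q n \<in> W n" "sum q S \<doteq> p" "p \<in> W m" "n \<in> S" "n \<noteq> m"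
  shows "q n \<doteq> 0"
proof -
  let ?q = "\<lambda>i. (if i \<in> S then q i else 0) - (if i = m then p else 0)"
  have "(\<Sum>i\<in>insert m S. if i \<in> S then q i else 0) = sum q S"
    using assms(1) by (intro sum.mono_neutral_cong_right) auto
  then have "sum ?q (insert m S) = sum q S - p"
    using assms(1) by (simp only: sum_subtractf) simp
  then have "sum ?q (insert m S) \<doteq> 0"
    using assms(3) by (simp add: cong_diff_0_iff)
  moreover have "?q i \<in> W i" for i
    using assms(2,4) by (auto intro!: W_diff W_uminus W_0)
  ultimately have "?q n \<doteq> 0"
    using assms(1,5) by (intro W_indep[of "insert m S" ?q]) auto
  with assms(5,6) show ?thesis
    by simp
qed

text \<open>This is the degree filtration: sums of homogeneous elements of degree below
  \<open>N\<close>, modulo the ideal. The inductive form spares most arguments the handling of index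
  sets.\<close>

inductive lower :: "int \<Rightarrow> heis_gen free_algebra \<Rightarrow> bool" for N
  where lower_0: "p \<doteq> 0 \<Longrightarrow> lower N p"
  | lower_step: "n < N \<Longrightarrow> w \<in> W n \<Longrightarrow> lower N p \<Longrightarrow> q \<doteq> w + p \<Longrightarrow> lower N q"

lemma lower_cong: "lower N p \<Longrightarrow> q \<doteq> p \<Longrightarrow> lower N q"
  by (induction rule: lower.induct) (blast intro: lower.intros cong_trans)+

lemma lower_W: "w \<in> W n \<Longrightarrow> n < N \<Longrightarrow> lower N w"
  using lower_step[of n N w 0 w] lower_0[of 0] by simp

lemma lower_mono: "lower N p \<Longrightarrow> N \<le> M \<Longrightarrow> lower M p"
  by (induction rule: lower.induct) (blast intro: lower.intros less_le_trans)+

lemma lower_add: "lower N p \<Longrightarrow> lower N q \<Longrightarrow> lower N (p + q)"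
proof (induction rule: lower.induct)
  case (lower_0 p)
  then show ?case
    using lower_cong[of N q "p + q"] cong_add[of p 0 q q] by simp
next
  case (lower_step n w p p')
  have "p' + q \<doteq> w + (p + q)"
    using cong_add[OF lower_step.hyps(4) cong_refl[of q]] by (simp add: add.assoc)
  with lower_step show ?case
    by (blast intro: lower.lower_step)
qed

lemma lower_mult_W:
  assumes "lower N p" "w \<in> W m"
  shows "lower (N + m) (w * p)" and "lower (N + m) (p * w)"
  using assms
proof (induction rule: lower.induct)
  case (lower_0 p)
  { case 1 with lower_0 show ?case using cong_mult_left[of p 0 w] by (auto intro: lower.lower_0) }
  { case 2 with lower_0 show ?case using cong_mult_right[of p 0 w] by (auto intro: lower.lower_0) }
next
  case (lower_step n v p q)
  { case 1
    have "w * q \<doteq> w * v + w * p"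
      using cong_mult_left[OF lower_step.hyps(4)] by (simp add: distrib_left)
    with lower_step 1 show ?case
      using W_mult[of w m v n] by (auto intro!: lower.lower_step[of "m + n" "N + m" "w * v" "w * p"]) }
  { case 2
    have "q * w \<doteq> v * w + p * w"
      using cong_mult_right[OF lower_step.hyps(4)] by (simp add: distrib_right)
    with lower_step 2 show ?case
      using W_mult[of v n w m] by (auto intro!: lower.lower_step[of "n + m" "N + m" "v * w" "p * w"]) }
qed

lemma lower_mult: "lower N p \<Longrightarrow> lower M q \<Longrightarrow> lower (N + M) (p * q)"
proof (induction rule: lower.induct)
  case (lower_0 p)
  then show ?case
    using cong_mult_right[of p 0 q] by (auto intro: lower.lower_0)
next
  case (lower_step n w p p')
  have "lower (N + M) (w * q)"
    using lower_mult_W(1)[OF lower_step.prems lower_step.hyps(2)] lower_step.hyps(1)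
    by (auto intro: lower_mono)
  then have "lower (N + M) (w * q + p * q)"
    using lower_step by (blast intro: lower_add)
  moreover have "p' * q \<doteq> w * q + p * q"
    using cong_mult_right[OF lower_step.hyps(4)] by (simp add: distrib_right)
  ultimately show ?case
    by (rule lower_cong)
qed

lemma lower_const: "lower N p \<Longrightarrow> lower N (free_const c * p)"
proof (induction rule: lower.induct)
  case (lower_0 p)
  then show ?case
    using cong_mult_left[of p 0 "free_const c"] by (auto intro: lower.lower_0)
next
  case (lower_step n w p q)
  have "free_const c * q \<doteq> free_const c * w + free_const c * p"
    using cong_mult_left[OF lower_step.hyps(4)] by (simp add: distrib_left)
  with lower_step show ?case
    using W_const by (blast intro: lower.lower_step)
qed

lemma lower_diff: "lower N p \<Longrightarrow> lower N q \<Longrightarrow> lower N (p - q)"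
  using lower_add[of N p "- q"] lower_const[of N q "- 1"]
  by (simp add: free_const_uminus free_const_1)

lemma lower_sum: "finite S \<Longrightarrow> (\<And>n. n \<in> S \<Longrightarrow> n < N \<and> q n \<in> W n) \<Longrightarrow> lower N (sum q S)"
  by (induction S rule: finite_induct) (auto intro: lower_0 lower_add lower_W)

lemma lower_imp_sum:
  assumes "lower N p"
  shows "\<exists>S q. finite S \<and> S \<subseteq> {..<N} \<and> (\<forall>n. q n \<in> W n) \<and> p \<doteq> sum q S"
  using assms
proof (induction rule: lower.induct)
  case (lower_0 p)
  then show ?case
    by (intro exI[of _ "{}"] exI[of _ "\<lambda>_. 0"]) (simp add: W_0)
next
  case (lower_step n w p p')
  then obtain S q where S: "finite S" "S \<subseteq> {..<N}" "\<And>n. q n \<in> W n" "p \<doteq> sum q S"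
    by blast
  \<comment> \<open>The degree \<open>n\<close> may already lie in \<open>S\<close>; then
    \<open>w\<close> is merged into the existing component.\<close>
  let ?q = "\<lambda>i. (if i \<in> S then q i else 0) + (if i = n then w else 0)"
  have "(\<Sum>i\<in>insert n S. if i \<in> S then q i else 0) = sum q S"
    using S(1) by (intro sum.mono_neutral_cong_right) auto
  then have "sum ?q (insert n S) = w + sum q S"
    using S(1) by (simp only: sum.distrib) (simp add: add.commute)
  moreover have "p' \<doteq> w + sum q S"
    using lower_step.hyps(4) cong_add[OF cong_refl S(4)] cong_trans by blast
  ultimately have "p' \<doteq> sum ?q (insert n S)"
    by metis
  then show ?case
    using S(1,2) lower_step.hyps(1,2)
    by (intro exI[of _ "insert n S"] exI[of _ ?q]) (auto intro!: W_add W_0 S(3))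
qed

lemma lower_W_cong_0:
  assumes "lower N p" "p \<in> W N"
  shows "p \<doteq> 0"
proof -
  obtain S q where S: "finite S" "S \<subseteq> {..<N}" "\<And>n. q n \<in> W n" "p \<doteq> sum q S"
    using lower_imp_sum[OF assms(1)] by blast
  then have "q n \<doteq> 0" if "n \<in> S" for n
    using W_component[of S q p N n] that assms(2) cong_sym by auto
  then have "sum q S \<doteq> 0"
    using cong_sum[of S q "\<lambda>_. 0"] by simp
  with S(4) show ?thesis
    by (rule cong_trans)
qed

text \<open>\<open>t\<close> may be congruent to 0, so \<open>N\<close> is only an upper bound for
  the degree. This keeps the notion stable under differences, where leading parts may
  cancel.\<close>

definition top_component :: "int \<Rightarrow> heis_gen free_algebra \<Rightarrow> heis_gen free_algebra \<Rightarrow> bool"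
  where "top_component N p t \<longleftrightarrow> t \<in> W N \<and> lower N (p - t)"

lemma top_component_lower: "top_component N p t \<Longrightarrow> N < M \<Longrightarrow> lower M p"
  using lower_add[of M t "p - t"] lower_mono[of N "p - t" M] lower_W[of t N M]
  by (simp add: top_component_def)

lemma top_component_cong_0: "top_component N p t \<Longrightarrow> lower N p \<Longrightarrow> t \<doteq> 0"
  using lower_diff[of N p "p - t"] lower_W_cong_0 by (simp add: top_component_def)

lemma top_component_mult:
  assumes "top_component N p t" "top_component M q s"
  shows "top_component (N + M) (p * q) (t * s)"
proof -
  have "p * q - t * s = t * (q - s) + (p - t) * s + (p - t) * (q - s)"
    by (simp add: algebra_simps)
  then show ?thesis
    using assms lower_mult_W[of M "q - s" t N] lower_mult_W[of N "p - t" s M]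
      lower_mult[of N "p - t" M "q - s"] W_mult[of t N s M]
    by (simp add: top_component_def lower_add add.commute)
qed

lemma top_component_diff:
  assumes "top_component N p t" "top_component N q s"
  shows "top_component N (p - q) (t - s)"
proof -
  have "p - q - (t - s) = (p - t) - (q - s)"
    by simp
  then show ?thesis
    using assms lower_diff W_diff unfolding top_component_def by metis
qed

lemma top_component_add_lower:
  assumes "top_component N p t" "lower N q"
  shows "top_component N (q + p) t"
  using assms lower_add[of N q "p - t"] by (simp add: top_component_def algebra_simps)

lemma top_component_const:
  "top_component N p t \<Longrightarrow> top_component N (p * free_const c) (t * free_const c)"
  using lower_const[of N "p - t" c] W_const[of t N c]
  by (simp add: top_component_def free_const_commute algebra_simps)

lemma top_component_Max:
  assumes "decomposition S q p" "S \<noteq> {}"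
  shows "top_component (Max S) p (q (Max S))"
proof -
  have S: "finite S" "\<And>n. n \<in> S \<Longrightarrow> q n \<in> W n" "p \<doteq> sum q S"
    using assms(1) by (auto simp: decomposition_def)
  have "Max S \<in> S"
    using S assms(2) by simp
  have "lower (Max S) (sum q (S - {Max S}))"
    using S(1,2) by (intro lower_sum) (auto simp: order.strict_iff_order)
  moreover have "p - q (Max S) \<doteq> sum q (S - {Max S})"
    using S(1) \<open>Max S \<in> S\<close> cong_diff[OF S(3) cong_refl[of "q (Max S)"]] by (simp add: sum_diff1)
  ultimately show ?thesis
    using S(2) \<open>Max S \<in> S\<close> lower_cong by (simp add: top_component_def)
qed

lemma decomposition_singleton: "decomposition {n} q p \<Longrightarrow> p \<in> W n"
  using W_cong[of "q n" n p] cong_sym[of p "q n"] by (simp add: decomposition_def)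

lemma decomposition_nonempty: "decomposition S q p \<Longrightarrow> \<not> p \<doteq> 0 \<Longrightarrow> S \<noteq> {}"
  by (auto simp: decomposition_def)

text \<open>For \<open>a > 0\<close> the degree bounds of the powers of \<open>h\<close> increase
  strictly, so the leading monomial of \<open>p\<close> alone determines the top component.\<close>

lemma top_component_mult_ev:
  assumes h: "top_component a gh t" and "a > 0" and u: "top_component b u s"
  shows "top_component (b + a * int (Polynomial.degree p)) (u * ev p)
    (s * free_const (lead_coeff p) * t ^ Polynomial.degree p)"
proof (induction p)
  \<comment> \<open>The zero polynomial has degree 0 and leading coefficient 0, so the top component
    claimed here is 0.\<close>
  case 0
  show ?case
    using u top_component_const[of b u s 0] by simp
next
  case (pCons c p)
  show ?case
  proof (cases "p = 0")
    case True
    then show ?thesis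
      using u by (simp add: top_component_const)
  next
    case False
    let ?N = "b + a * int (Polynomial.degree p) + a"
    have "a * int (Polynomial.degree p) + a > 0"
      using \<open>a > 0\<close> by (simp add: add_nonneg_pos)
    then have "lower ?N (u * free_const c)"
      using top_component_lower[OF top_component_const[OF u], of ?N] by simp
    then have "top_component ?N (u * free_const c + u * ev p * gh)
        (s * free_const (lead_coeff p) * t ^ Polynomial.degree p * t)"
      by (intro top_component_add_lower top_component_mult pCons.IH h)
    then show ?thesis
      using False by (simp add: free_eval_pCons distrib_left power_commutes add.commute mult.assoc
          flip: add.assoc)
  qed
qed

section \<open>The generator \<open>h\<close> has degree 0\<close>

lemma power_cong_0: "t ^ n \<doteq> 0 \<Longrightarrow> t \<doteq> 0"
proof (induction n)
  case 0
  then show ?case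
    using cong_mult_left[of 1 0 t] by simp
next
  case (Suc n)
  then show ?case
    using cong_0_prime by auto
qed

text \<open>A nonzero scalar is a unit, so if it were congruent to 0, everything would be; this
  contradicts any element known to be nonzero.\<close>

lemma const_cong_0:
  assumes "c \<noteq> 0" "free_const c \<doteq> 0"
  shows "p \<doteq> 0"
proof -
  have "free_const (inverse c) * free_const c = (1 :: heis_gen free_algebra)"
    using assms(1) by (simp add: free_const_1 flip: free_const_mult)
  then show ?thesis
    using cong_mult[OF cong_refl[of "p * free_const (inverse c)"] assms(2)] by (simp add: mult.assoc)
qed

text \<open>If \<open>?a > 0\<close>, then \<open>?b + ?a\<close>, the top degree of
  \<open>h x\<close>, lies below \<open>?N\<close>. So the degree \<open>?N\<close> component of
  \<open>x f(h)\<close> must vanish, although it is a product of nonzero factors.\<close>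

lemma h_degree_le_0:
  assumes "decomposition S q gh" "n \<in> S"
  shows "n \<le> 0"
proof (rule ccontr)
  assume "\<not> n \<le> 0"
  let ?a = "Max S" and ?d = "Polynomial.degree f"
  have S: "finite S" "\<And>n. n \<in> S \<Longrightarrow> \<not> q n \<doteq> 0"
    using assms(1) by (auto simp: decomposition_def)
  have "?a > 0"
    using \<open>\<not> n \<le> 0\<close> Max_ge[OF S(1) assms(2)] by linarith
  have h: "top_component ?a gh (q ?a)"
    using assms by (intro top_component_Max) auto
  obtain T r where T: "decomposition T r gx"
    using decomposition_exists by blast
  then have "T \<noteq> {}"
    using x_not_cong_0 by (rule decomposition_nonempty)
  let ?b = "Max T"
  have x: "top_component ?b gx (r ?b)"
    using T \<open>T \<noteq> {}\<close> by (rule top_component_Max)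
  let ?N = "?b + ?a * int ?d"
  have "?a * 1 < ?a * int ?d"
    using \<open>?a > 0\<close> degree_gt_1 by (intro mult_strict_left_mono) simp_all
  then have "lower ?N (gh * gx)"
    using top_component_lower[OF top_component_mult[OF h x]] by simp
  then have "lower ?N (gx * ev f)"
    using lower_cong cong_sym[OF rel_hx] by blast
  then have "r ?b * free_const (lead_coeff f) * q ?a ^ ?d \<doteq> 0"
    using top_component_cong_0[OF top_component_mult_ev[OF h \<open>?a > 0\<close> x]] by blast
  moreover have "\<not> r ?b \<doteq> 0"
    using T \<open>T \<noteq> {}\<close> by (auto simp: decomposition_def)
  moreover have "\<not> q ?a \<doteq> 0"
    using S assms(2) Max_in by blast
  moreover have "lead_coeff f \<noteq> 0"
    using degree_gt_1 by auto
  ultimately show False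
    using cong_0_prime power_cong_0 const_cong_0 by blast
qed

text \<open>Reversing the grading turns every upper bound on degrees into a lower bound.\<close>

lemma heisenberg_grading_uminus: "heisenberg_grading f (\<lambda>n. W (- n))"
proof (unfold_locales)
  show "\<exists>S q. finite S \<and> (\<forall>n \<in> S. q n \<in> W (- n)) \<and> p \<doteq> sum q S" for p
  proof -
    obtain S q where "finite S" "\<forall>n \<in> S. q n \<in> W n" "p \<doteq> sum q S"
      using W_decomp by blast
    then show ?thesis
      by (intro exI[of _ "uminus ` S"] exI[of _ "\<lambda>n. q (- n)"]) (auto simp: sum.reindex)
  qed
  show "q n \<doteq> 0" if "finite S" "\<And>n. n \<in> S \<Longrightarrow> q n \<in> W (- n)" "sum q S \<doteq> 0" "n \<in> S" for S q n
  proof -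
    have "q (- m) \<in> W m" if "m \<in> uminus ` S" for m
      using that \<open>\<And>n. n \<in> S \<Longrightarrow> q n \<in> W (- n)\<close>[of "- m"] by auto
    then show ?thesis
      using that W_indep[of "uminus ` S" "\<lambda>n. q (- n)" "- n"] by (simp add: sum.reindex)
  qed
next
  show "p * q \<in> W (- (m + n))" if "p \<in> W (- m)" "q \<in> W (- n)" for p q m n
    using W_mult[OF that] by simp
qed (fact W_0 W_add W_const W_cong)+

lemma decomposition_uminus:
  assumes "decomposition S q p"
  shows "heisenberg_grading.decomposition f (\<lambda>n. W (- n)) (uminus ` S) (\<lambda>n. q (- n)) p"
proof -
  interpret neg: heisenberg_grading f "\<lambda>n. W (- n)"
    by (rule heisenberg_grading_uminus)
  show ?thesis
    using assms by (auto simp: decomposition_def neg.decomposition_def sum.reindex)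
qed

lemma h_in_W_0: "gh \<in> W 0"
proof -
  interpret neg: heisenberg_grading f "\<lambda>n. W (- n)"
    by (rule heisenberg_grading_uminus)
  obtain S q where S: "decomposition S q gh"
    using decomposition_exists by blast
  have "n = 0" if "n \<in> S" for n
    using h_degree_le_0[OF S that] neg.h_degree_le_0[OF decomposition_uminus[OF S], of "- n"] that
    by simp
  then have "S \<subseteq> {0}"
    by auto
  moreover have "S \<noteq> {}"
    using S h_not_cong_0 by (rule decomposition_nonempty)
  ultimately have "S = {0}"
    by auto
  then show ?thesis
    using S decomposition_singleton by simp
qed

section \<open>Consequences for the components of \<open>x\<close> and \<open>y\<close>\<close>

lemma W_mult_ev: "w \<in> W n \<Longrightarrow> w * ev p \<in> W n"
proof (induction p)
  case (pCons c p)
  then have "free_const c * w + w * ev p * gh \<in> W n"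
    using W_mult[OF _ h_in_W_0] by (auto intro: W_add W_const)
  then show ?case
    by (simp add: free_eval_pCons free_const_commute algebra_simps)
qed (simp add: W_0)

lemma W_ev_mult: "w \<in> W n \<Longrightarrow> ev p * w \<in> W n"
proof (induction p)
  case (pCons c p)
  then have "free_const c * w + gh * (ev p * w) \<in> W n"
    using W_mult[OF h_in_W_0] by (auto intro: W_add W_const)
  then show ?case
    by (simp add: free_eval_pCons free_eval_commute algebra_simps)
qed (simp add: W_0)

text \<open>That the unit has degree 0 is not an axiom here. Multiplying a decomposition of 1 by
  \<open>h\<close> decomposes \<open>h\<close> itself, so \<open>gh * q n\<close> vanishes for
  \<open>n\<close> other than 0, and then so does \<open>q n\<close>.\<close>

lemma one_in_W_0: "1 \<in> W 0"
proof -
  obtain S q where "decomposition S q 1"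
    using decomposition_exists by blast
  then have S: "finite S" "\<And>n. n \<in> S \<Longrightarrow> q n \<in> W n \<and> \<not> q n \<doteq> 0" "1 \<doteq> sum q S"
    by (auto simp: decomposition_def)
  have "(\<Sum>n\<in>S. gh * q n) \<doteq> gh"
    using cong_sym[OF cong_mult_left[OF S(3), of gh]] by (simp add: sum_distrib_left)
  then have "gh * q n \<doteq> 0" if "n \<in> S" "n \<noteq> 0" for n
    using W_component[of S "\<lambda>n. gh * q n" gh 0 n] S W_mult[OF h_in_W_0] h_in_W_0 that by auto
  then have "S \<subseteq> {0}"
    using S(2) cong_0_prime h_not_cong_0 by blast
  then have "sum q S \<in> W 0"
    using S(2) W_0 by (cases "S = {}") (auto simp: subset_singleton_iff)
  then show ?thesis
    using S(3) W_cong cong_sym by blast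
qed

lemma ev_in_W_0: "ev p \<in> W 0"
  using W_mult_ev[OF one_in_W_0] by simp

text \<open>Multiplication by \<open>h\<close> or \<open>f(h)\<close> preserves degrees, so the
  relation for \<open>x\<close> splits into one relation per component.\<close>

lemma x_component:
  assumes "decomposition S q gx" "n \<in> S"
  shows "gh * q n \<doteq> q n * ev f"
proof -
  have S: "finite S" "\<And>n. n \<in> S \<Longrightarrow> q n \<in> W n" "gx \<doteq> sum q S"
    using assms(1) by (auto simp: decomposition_def)
  have "gh * sum q S \<doteq> sum q S * ev f"
    using rel_hx S(3) by (meson cong_mult_left cong_mult_right cong_sym cong_trans)
  then have "(\<Sum>n\<in>S. gh * q n - q n * ev f) \<doteq> 0"
    by (simp add: sum_subtractf cong_diff_0_iff sum_distrib_left sum_distrib_right)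
  then show ?thesis
    using W_indep[of S "\<lambda>n. gh * q n - q n * ev f" n] S assms(2) W_mult_ev W_mult[OF h_in_W_0]
    by (auto simp: W_diff cong_diff_0_iff)
qed

lemma y_component:
  assumes "decomposition S q gy" "n \<in> S"
  shows "q n * gh \<doteq> ev f * q n"
proof -
  have S: "finite S" "\<And>n. n \<in> S \<Longrightarrow> q n \<in> W n" "gy \<doteq> sum q S"
    using assms(1) by (auto simp: decomposition_def)
  have "sum q S * gh \<doteq> ev f * sum q S"
    using rel_yh S(3) by (meson cong_mult_left cong_mult_right cong_sym cong_trans)
  then have "(\<Sum>n\<in>S. q n * gh - ev f * q n) \<doteq> 0"
    by (simp add: sum_subtractf cong_diff_0_iff sum_distrib_left sum_distrib_right)
  then show ?thesis
    using W_indep[of S "\<lambda>n. q n * gh - ev f * q n" n] S assms(2) W_ev_mult W_mult[OF _ h_in_W_0]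
    by (auto simp: W_diff cong_diff_0_iff)
qed

lemma xy_degree_le_0:
  assumes S: "decomposition S q gx" and T: "decomposition T r gy" and "m \<in> S" "n \<in> T"
  shows "m + n \<le> 0"
proof (rule ccontr)
  assume "\<not> m + n \<le> 0"
  let ?b = "Max S" and ?c = "Max T"
  have fin: "finite S" "finite T"
    using S T by (auto simp: decomposition_def)
  have "?b + ?c > 0"
    using \<open>\<not> m + n \<le> 0\<close> Max_ge[OF fin(1) \<open>m \<in> S\<close>] Max_ge[OF fin(2) \<open>n \<in> T\<close>] by linarith
  have b: "?b \<in> S" and c: "?c \<in> T"
    using fin assms(3,4) Max_in by blast+
  have x: "top_component ?b gx (q ?b)" and y: "top_component ?c gy (r ?c)"
    using S T assms(3,4) by (auto intro: top_component_Max)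
  have "top_component (?b + ?c) (gy * gx - gx * gy) (r ?c * q ?b - q ?b * r ?c)"
    using top_component_diff[OF top_component_mult[OF y x, unfolded add.commute[of ?c]]
        top_component_mult[OF x y]] .
  \<comment> \<open>\<open>f(h) - h\<close> lies in degree 0, below \<open>?b + ?c\<close>; hence
    the commutator of the two top components vanishes.\<close>
  moreover have "lower (?b + ?c) (gy * gx - gx * gy)"
    using lower_cong[OF _ rel_yx] lower_W[OF W_diff[OF ev_in_W_0 h_in_W_0] \<open>?b + ?c > 0\<close>] by blast
  ultimately have "r ?c * q ?b \<doteq> q ?b * r ?c"
    using top_component_cong_0 cong_diff_0_iff by blast
  then have "q ?b \<doteq> 0 \<or> r ?c \<doteq> 0"
    by (rule raising_lowering_not_commute[OF x_component[OF S b] y_component[OF T c]])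
  then show False
    using S T b c by (auto simp: decomposition_def)
qed

lemma xy_homogeneous: "\<exists>l. gx \<in> W l \<and> gy \<in> W (- l)"
proof -
  interpret neg: heisenberg_grading f "\<lambda>n. W (- n)"
    by (rule heisenberg_grading_uminus)
  obtain S q where S: "decomposition S q gx"
    using decomposition_exists by blast
  obtain T r where T: "decomposition T r gy"
    using decomposition_exists by blast
  have *: "n = - m" if "m \<in> S" "n \<in> T" for m n
    using xy_degree_le_0[OF S T that] that
      neg.xy_degree_le_0[OF decomposition_uminus[OF S] decomposition_uminus[OF T], of "- m" "- n"]
    by simp
  obtain l where l: "l \<in> S"
    using decomposition_nonempty[OF S x_not_cong_0] by blast
  obtain k where k: "k \<in> T"
    using decomposition_nonempty[OF T y_not_cong_0] by blast
  \<comment> \<open>Each degree of \<open>x\<close> is the negative of each degree of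
    \<open>y\<close>, so fixing one of either kind determines all of the other.\<close>
  have "T = {- l}"
    using *[OF l] k *[OF l k] by blast
  moreover have "m = l" if "m \<in> S" for m
    using *[OF that k] *[OF l k] by simp
  then have "S = {l}"
    using l by blast
  ultimately show ?thesis
    using S T decomposition_singleton by blast
qed

end

section \<open>Passage from gradings of the quotient to the free algebra\<close>

lemma finsum_heis_class:
  assumes "finite S"
  shows "finsum (gen_heisenberg f) (\<lambda>n. heis_class f (q n)) S = heis_class f (sum q S)"
proof -
  interpret ring "gen_heisenberg f" by (rule ring_gen_heisenberg)
  show ?thesis
    using assms by (induction S rule: finite_induct) (auto simp: gen_heisenberg_simps)
qed

lemma (in heisenberg) heis_class_eq_iff_cong: "heis_class f p = heis_class f q \<longleftrightarrow> p \<doteq> q"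
  by (simp add: heis_class_eq_iff cong_def)

text \<open>Existence of the family of components gives \<open>W_decomp\<close>. Uniqueness, used
  only for the element 0, gives \<open>W_indep\<close>.\<close>

lemma heisenberg_grading_Z_grading:
  assumes "Polynomial.degree f > 1" and V: "Z_grading (gen_heisenberg f) V"
  shows "heisenberg_grading f (\<lambda>n. {p. heis_class f p \<in> V n})"
proof -
  interpret heisenberg f
    by unfold_locales (fact assms(1))
  interpret H: module complex_ring "gen_heisenberg f"
    by (rule module_gen_heisenberg)
  note simps = gen_heisenberg_simps heis_class_eq_iff_cong
  have sub: "submodule (V n) complex_ring (gen_heisenberg f)" for n
    using V by (simp add: Z_grading_def)
  have zero: "heis_class f 0 \<in> V n" for n
    using subgroup.one_closed[OF submodule.axioms(1)[OF sub[of n]]] by (simp add: simps)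
  define family where "family p v \<longleftrightarrow> (\<forall>n. v n \<in> V n) \<and> finite {n. v n \<noteq> heis_class f 0} \<and>
      heis_class f p = finsum (gen_heisenberg f) v {n. v n \<noteq> heis_class f 0}" for p v
  have uniq: "\<exists>!v. family p v" for p
  proof -
    have "heis_class f p \<in> carrier (gen_heisenberg f)"
      by (simp add: gen_heisenberg_simps)
    from V[unfolded Z_grading_def, THEN conjunct2, THEN conjunct1, rule_format, OF this]
    show ?thesis
      unfolding family_def gen_heisenberg_simps .
  qed
  show ?thesis
  proof (unfold_locales, simp_all only: mem_Collect_eq)
    show "heis_class f 0 \<in> V n" for n
      by (rule zero)
    show "heis_class f (p + q) \<in> V n" if "heis_class f p \<in> V n" "heis_class f q \<in> V n" for p q n
      using H.submoduleE(5)[OF sub that] by (simp add: simps)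
    show "heis_class f (free_const c * p) \<in> V n" if "heis_class f p \<in> V n" for p n c
      using H.submoduleE(4)[OF sub _ that, of c] by (simp add: simps)
    show "heis_class f (p * q) \<in> V (m + n)" if "heis_class f p \<in> V m" "heis_class f q \<in> V n" for p q m n
      using V[unfolded Z_grading_def, THEN conjunct2, THEN conjunct2, rule_format, OF that]
      by (simp add: simps)
    show "heis_class f q \<in> V n" if "heis_class f p \<in> V n" "p \<doteq> q" for p q n
      using that by (metis heis_class_eq_iff_cong)
    show "\<exists>S q. finite S \<and> (\<forall>n \<in> S. heis_class f (q n) \<in> V n) \<and> p \<doteq> sum q S" for p
    proof -
      obtain v where v: "\<And>n. v n \<in> V n" "finite {n. v n \<noteq> heis_class f 0}"
        "heis_class f p = finsum (gen_heisenberg f) v {n. v n \<noteq> heis_class f 0}"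
        using uniq[of p] unfolding family_def by blast
      have "\<exists>q. v n = heis_class f q" for n
        using H.submoduleE(1)[OF sub[of n]] v(1)[of n] by (auto simp: simps)
      then obtain q where "\<And>n. v n = heis_class f (q n)"
        by metis
      then have q: "v = (\<lambda>n. heis_class f (q n))"
        by blast
      have "p \<doteq> sum q {n. v n \<noteq> heis_class f 0}"
        using v(2,3) finsum_heis_class[OF v(2), of f q] by (simp add: q simps)
      then show ?thesis
        using v(1,2) unfolding q by (intro exI conjI ballI)
    qed
    show "q n \<doteq> 0" if S: "finite S" "\<And>n. n \<in> S \<Longrightarrow> heis_class f (q n) \<in> V n" "sum q S \<doteq> 0" "n \<in> S"
      for S q n
    proof -
      \<comment> \<open>Uniqueness concerns families indexed by all integers, so \<open>q\<close> is
        extended by 0 outside \<open>S\<close>. The result and the zero family \<open>?z\<close>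
        both decompose 0 and therefore agree.\<close>
      define q' where "q' n = (if n \<in> S \<and> \<not> q n \<doteq> 0 then q n else 0)" for n
      let ?v = "\<lambda>n. heis_class f (q' n)" and ?z = "\<lambda>n::int. heis_class f 0"
      have supp: "{n. ?v n \<noteq> heis_class f 0} = {n \<in> S. \<not> q n \<doteq> 0}"
        by (auto simp: q'_def simps)
      have "sum q' {n \<in> S. \<not> q n \<doteq> 0} = sum q' S"
        using S(1) by (intro sum.mono_neutral_left) (auto simp: q'_def)
      also have "\<dots> \<doteq> sum q S"
        by (rule cong_sum) (auto simp: q'_def intro: cong_sym)
      also have "\<dots> \<doteq> 0"
        by (rule S(3))
      finally have "heis_class f 0 = finsum (gen_heisenberg f) ?v {n. ?v n \<noteq> heis_class f 0}"
        unfolding supp using S(1) by (subst finsum_heis_class) (auto simp: simps intro: cong_sym)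
      moreover have "\<forall>n. ?v n \<in> V n"
        using S(2) zero by (auto simp: q'_def)
      moreover have "finite {n. ?v n \<noteq> heis_class f 0}"
        unfolding supp using S(1) by simp
      moreover have "heis_class f 0 = finsum (gen_heisenberg f) ?z {n. ?z n \<noteq> heis_class f 0}"
        using H.finsum_empty[of ?z] by (simp add: simps)
      ultimately have "family 0 ?v" "family 0 ?z"
        using zero by (simp_all add: family_def)
      then have "?v = ?z"
        using uniq[of 0] by blast
      then have "q' n \<doteq> 0"
        by (metis heis_class_eq_iff_cong)
      then show ?thesis
        using S(4) by (auto simp: q'_def split: if_splits)
    qed
  qed
qed

theorem corollary4p10:
  fixes f :: "complex poly" and V :: "int \<Rightarrow> heis_gen free_algebra set set"
  assumes "Polynomial.degree f > 1"
    and "Z_grading (gen_heisenberg f) V"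
  shows "\<exists>l :: int. homogeneous V l (heis_x f) \<and> homogeneous V (- l) (heis_y f) \<and>
    homogeneous V 0 (heis_h f)"
proof -
  interpret heisenberg_grading f "\<lambda>n. {p. heis_class f p \<in> V n}"
    using assms by (rule heisenberg_grading_Z_grading)
  show ?thesis
    using xy_homogeneous h_in_W_0
    by (auto simp: homogeneous_def heis_x_def heis_y_def heis_h_def)
qed

end
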